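(* Let $T$ be a tree. If $M_T(x)$ is irreducible over $\mathbb Q$, then every graph generalized cospectral with $T$ is a tree.
   Context: All graphs are finite, simple and undirected. Two graphs are generalized cospectral if they have the same adjacency spectrum and their complements have the same adjacency spectrum. An adjacency eigenvalue of a graph $G$ is main if its eigenspace is not orthogonal to the all-one vector; the main polynomial $M_G(x)$ is the product of $(x-\lambda)$ over the distinct main eigenvalues $\lambda$ of $G$ (it lies in $\mathbb Z[x]$). *)

theory Defs
  imports
    "Graph_Theory.Pair_Digraph"
    "Graph_Theory.Digraph_Component"
    "Jordan_Normal_Form.Char_Poly"
    "HOL-Computational_Algebra.Polynomial_Factorial"
begin

text \<open>
  A finite simple undirected graph is a \<^locale>\<open>pair_graph\<close>: finite, loopfree, with a symmetric
  set of arcs, so that an edge \<open>uv\<close> is the pair of arcs \<open>(u,v)\<close>, \<open>(v,u)\<close>.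
\<close>

definition complement_graph :: "'a pair_pre_digraph \<Rightarrow> 'a pair_pre_digraph" where
  "complement_graph G =
     \<lparr> pverts = pverts G,
       parcs = {(u, v) \<in> pverts G \<times> pverts G. u \<noteq> v \<and> (u, v) \<notin> parcs G} \<rparr>"

lemma pair_graph_complement_graph:
  assumes "pair_graph G" shows "pair_graph (complement_graph G)"
proof -
  interpret pair_graph G by (rule assms)
  have "finite (parcs (complement_graph G))"
    by (rule finite_subset[of _ "pverts G \<times> pverts G"])
      (auto simp: complement_graph_def pair_finite_verts)
  moreover have "symmetric (complement_graph G)"
    by (auto simp: symmetric_def complement_graph_def intro!: symI dest: arcs_symmetric)
  ultimately show ?thesis
    by unfold_locales (auto simp: complement_graph_def pair_finite_verts)
qed

text \<open>
  The library's \<^const>\<open>tree\<close> is about digraphs: it counts the closed walk \<open>u, v, u\<close> as a cycle, so a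
  symmetric digraph with an edge is never a tree in that sense. A cycle of an undirected graph has
  at least three edges. The library's notion of connectedness includes that there is a vertex.
\<close>

definition undirected_tree :: "'a pair_pre_digraph \<Rightarrow> bool" where
  "undirected_tree G \<longleftrightarrow>
     Digraph_Component.connected (with_proj G) \<and>
     (\<nexists>p. pre_digraph.cycle (with_proj G) p \<and> length p \<ge> 3)"

text \<open>
  The rows and columns of the adjacency matrix follow some fixed enumeration of the vertices.
  Another enumeration conjugates the matrix by a permutation matrix, which changes neither the
  spectrum nor the main eigenvalues.
\<close>

definition vert_list :: "'a pair_pre_digraph \<Rightarrow> 'a list" where
  "vert_list G = (SOME vs. distinct vs \<and> set vs = pverts G)"

lemma vert_list:
  assumes "finite (pverts G)"
  shows "distinct (vert_list G)" "set (vert_list G) = pverts G"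
    "length (vert_list G) = card (pverts G)"
proof -
  have "\<exists>vs. distinct vs \<and> set vs = pverts G"
    using finite_distinct_list[OF assms] by blast
  then have *: "distinct (vert_list G) \<and> set (vert_list G) = pverts G"
    unfolding vert_list_def by (rule someI_ex)
  then show "distinct (vert_list G)" "set (vert_list G) = pverts G"
    "length (vert_list G) = card (pverts G)"
    using distinct_card[of "vert_list G"] by auto
qed

definition adjacency_matrix :: "'a pair_pre_digraph \<Rightarrow> real mat" where
  "adjacency_matrix G =
     mat (card (pverts G)) (card (pverts G))
       (\<lambda>(i, j). if (vert_list G ! i, vert_list G ! j) \<in> parcs G then 1 else 0)"

text \<open>
  Eigenvalues with multiplicity. Since the adjacency matrix is real symmetric, no root of its
  characteristic polynomial is lost by working over the reals.
\<close>

definition adjacency_spectrum :: "'a pair_pre_digraph \<Rightarrow> real multiset" where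
  "adjacency_spectrum G = proots (char_poly (adjacency_matrix G))"

definition generalized_cospectral :: "'a pair_pre_digraph \<Rightarrow> 'b pair_pre_digraph \<Rightarrow> bool" where
  "generalized_cospectral G H \<longleftrightarrow>
     adjacency_spectrum G = adjacency_spectrum H \<and>
     adjacency_spectrum (complement_graph G) = adjacency_spectrum (complement_graph H)"

definition main_eigenvalue :: "'a pair_pre_digraph \<Rightarrow> real \<Rightarrow> bool" where
  "main_eigenvalue G k \<longleftrightarrow>
     (\<exists>v. eigenvector (adjacency_matrix G) v k \<and> v \<bullet> vec (card (pverts G)) (\<lambda>_. 1) \<noteq> 0)"

definition main_poly :: "'a pair_pre_digraph \<Rightarrow> real poly" where
  "main_poly G = (\<Prod>k\<in>{k. main_eigenvalue G k}. [:- k, 1:])"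

definition irreducible_over_rat :: "real poly \<Rightarrow> bool" where
  "irreducible_over_rat p \<longleftrightarrow> (\<exists>q :: rat poly. map_poly of_rat q = p \<and> irreducible q)"

end

theory Submission
  imports Defs "Jordan_Normal_Form.Schur_Decomposition" "HOL-Computational_Algebra.Field_as_Ring"
begin

text \<open>
  A number \<open>a\<close> is a main eigenvalue of a graph if and only if its multiplicity exceeds the
  multiplicity of \<open>- 1 - a\<close> in the complement; so generalized cospectral graphs have the same main
  eigenvalues. The largest eigenvalue \<open>c\<close> of a tree \<open>T\<close> is simple and main by Perron's argument.
  If \<open>G\<close> were disconnected, then each of two complementary unions of components would have
  a main eigenvalue, which is main for \<open>G\<close> and hence conjugate over the rationals to \<open>c\<close>; so \<open>c\<close>
  would be an eigenvalue of both parts, and not simple. Finally the sum of the squares of the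
  eigenvalues counts the arcs, and a connected graph is a tree if and only if it has one edge less
  than it has vertices.
\<close>

section \<open>Orthogonal diagonalization of real symmetric matrices\<close>

text \<open>Multiplicities are root counts of characteristic polynomials, while the comparison with
  the complement concerns eigenspaces. Orthonormal eigenbases of real symmetric matrices join the
  two: a root count becomes a number of basis indices. Perron's argument is applied to
  \<open>T\<close> alone, since connectedness of \<open>G\<close> is the goal; that \<open>c\<close>
  is a simple eigenvalue of \<open>G\<close> is read off the common spectrum. A union of components
  has a main eigenvalue because its all-one vector is nonzero and so cannot be orthogonal to a whole
  eigenbasis; the eigenvector, extended by zeros, keeps its coordinate sum. Conjugacy enters as
  divisibility: an irreducible polynomial that shares a root with a rational characteristic
  polynomial divides it. Blocks stay matrices of full size, padded with zeros, so that indices never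
  change. The price is a spurious eigenvalue 0, so \<open>c = 0\<close> has to be excluded, and the
  tree with one vertex is treated apart.\<close>

lemma symmetric_complex_eigenvalue_real:
  fixes A :: "real mat"
  assumes A: "A \<in> carrier_mat n n" and sym: "A\<^sup>T = A"
    and ev: "eigenvalue (map_mat complex_of_real A) a"
  shows "a \<in> \<real>"
proof -
  define C where "C = map_mat complex_of_real A"
  have C: "C \<in> carrier_mat n n" and symC: "C\<^sup>T = C"
    using A arg_cong[OF sym, of "map_mat complex_of_real"] by (auto simp: C_def map_mat_transpose)
  obtain v where v: "v \<in> carrier_vec n" "v \<noteq> 0\<^sub>v n" "C *\<^sub>v v = a \<cdot>\<^sub>v v"
    using ev C unfolding eigenvalue_def eigenvector_def C_def[symmetric] by auto
  have conjC: "conjugate (C *\<^sub>v v) = C *\<^sub>v conjugate v"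
    using A v(1) by (intro eq_vecI) (auto simp: C_def scalar_prod_def conjugate_complex_def)
  \<comment> \<open>The Hermitian form of \<open>C\<close> at \<open>v\<close> is evaluated by
    letting \<open>C\<close> act on either argument; the eigenvalue comes out once as
    \<open>a\<close> and once as \<open>cnj a\<close>.\<close>
  have "a * (v \<bullet>c v) = (C *\<^sub>v v) \<bullet>c v"
    using v by simp
  also have "\<dots> = (conjugate v \<bullet> (C *\<^sub>v v))"
    using v C by (subst comm_scalar_prod[of _ n]) auto
  also have "\<dots> = (C\<^sup>T *\<^sub>v conjugate v) \<bullet> v"
    using v C by (simp add: transpose_vec_mult_scalar[of C n n])
  also have "\<dots> = conjugate (C *\<^sub>v v) \<bullet> v"
    by (simp add: symC conjC)
  also have "\<dots> = cnj a * (v \<bullet>c v)"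
    using v by (simp add: conjugate_smult_vec comm_scalar_prod[of v n])
  finally have "(a - cnj a) * (v \<bullet>c v) = 0"
    by (simp add: algebra_simps)
  then have "a = cnj a"
    using v by auto
  then show ?thesis
    by (metis Reals_cnj_iff)
qed

text \<open>Over the complex numbers the polynomial splits, and the roots are real; the injective
  embedding of real polynomials carries the factorization back.\<close>

lemma symmetric_char_poly_splits:
  fixes A :: "real mat"
  assumes A: "A \<in> carrier_mat n n" and sym: "A\<^sup>T = A"
  shows "\<exists>es. char_poly A = (\<Prod>e\<leftarrow>es. [:- e, 1:])"
proof -
  define C where "C = map_mat complex_of_real A"
  have C: "C \<in> carrier_mat n n"
    using A by (simp add: C_def)
  obtain as where as: "char_poly C = (\<Prod>a\<leftarrow>as. [:- a, 1:])"
    using char_poly_factorized[OF C] by auto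
  have re: "a = of_real (Re a)" if "a \<in> set as" for a
  proof -
    have "eigenvalue C a"
      using that linear_poly_root[of a as] by (simp add: eigenvalue_root_char_poly[OF C] as)
    then show ?thesis
      using symmetric_complex_eigenvalue_real[OF A sym] by (simp add: C_def)
  qed
  interpret P: map_poly_inj_comm_ring_hom complex_of_real ..
  have "map_poly of_real (char_poly A) = char_poly C"
    using A by (simp add: of_real_hom.char_poly_hom C_def)
  also have "\<dots> = (\<Prod>a\<leftarrow>as. map_poly of_real [:- Re a, 1:])"
    unfolding as using re by (intro arg_cong[of _ _ prod_list] map_cong) auto
  also have "\<dots> = map_poly of_real (\<Prod>e\<leftarrow>map Re as. [:- e, 1:])"
    by (simp add: P.hom_prod_list o_def)
  finally show ?thesis
    by (metis P.injectivity)
qed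

text \<open>Gram-Schmidt on a basis that begins with \<open>v\<close> leaves \<open>v\<close> in
  place, and so does normalization, since \<open>v\<close> already has length 1.\<close>

lemma orthonormal_basis_extension:
  fixes v :: "real vec"
  assumes v: "v \<in> carrier_vec n" and vv: "v \<bullet> v = 1"
  shows "\<exists>W \<in> carrier_mat n n. W\<^sup>T * W = 1\<^sub>m n \<and> W * W\<^sup>T = 1\<^sub>m n \<and> col W 0 = v"
proof -
  have v0: "v \<noteq> 0\<^sub>v n"
    using vv v by auto
  then have n: "n > 0"
    using v by (cases n) auto
  interpret cof_vec_space n "TYPE(real)" .
  define b where "b = basis_completion v"
  from basis_completion[OF v v0, folded b_def]
  have b: "span (set b) = carrier_vec n" "distinct b" "\<not> lin_dep (set b)" "set b \<subseteq> carrier_vec n"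
    "hd b = v" "length b = n"
    by auto
  define ws where "ws = gram_schmidt n b"
  have ws: "set ws \<subseteq> carrier_vec n" "corthogonal ws" "length ws = n"
    using gram_schmidt_result[OF b(4) b(2) b(3) ws_def] b(6) by auto
  obtain vs where bv: "b = v # vs"
    using b(5,6) n by (cases b) auto
  have hd: "ws ! 0 = v"
    using gram_schmidt_hd[OF v, of vs] ws(3) n hd_conv_nth[of ws]
    by (metis bv length_0_conv less_numeral_extra(3) ws_def)
  define us where "us = map (\<lambda>w. (1 / sqrt (w \<bullet> w)) \<cdot>\<^sub>v w) ws"
  have us: "set us \<subseteq> carrier_vec n" "length us = n"
    using ws by (auto simp: us_def)
  have orth: "us ! i \<bullet> us ! j = (if i = j then 1 else 0)" if "i < n" "j < n" for i j
  proof -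
    have c: "ws ! i \<in> carrier_vec n" "ws ! j \<in> carrier_vec n"
      using that ws by auto
    have "(ws ! i \<bullet> ws ! j = 0) = (i \<noteq> j)"
      using corthogonalD[OF ws(2), of i j] that ws(3) by simp
    moreover have "ws ! i \<bullet> ws ! i \<ge> 0"
      by (simp add: scalar_prod_def sum_nonneg)
    ultimately show ?thesis
      using that ws(3) c by (auto simp: us_def)
  qed
  define W where "W = mat_of_cols n us"
  have W: "W \<in> carrier_mat n n"
    using us mat_of_cols_carrier(1)[of n us] by (simp add: W_def)
  have col: "col W i = us ! i" if "i < n" for i
    using that us by (auto simp: W_def intro!: col_mat_of_cols)
  have WW: "W\<^sup>T * W = 1\<^sub>m n"
    using W by (intro eq_matI) (auto simp: col orth)
  have "W * W\<^sup>T = 1\<^sub>m n"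
    using mat_mult_left_right_inverse[OF _ W WW] W by simp
  moreover have "col W 0 = v"
    using n ws(3) vv v by (simp add: col us_def hd)
  ultimately show ?thesis
    using W WW by blast
qed

text \<open>Deflation: with a unit eigenvector for \<open>e\<close> as first column of an orthogonal
  \<open>W\<close>, the matrix \<open>W\<^sup>T * A * W\<close> splits off the entry
  \<open>e\<close>, and the remaining block is symmetric with roots \<open>es\<close>.\<close>

lemma orthogonal_diagonalization:
  fixes A :: "real mat"
  assumes "A \<in> carrier_mat n n" and "A\<^sup>T = A" and "char_poly A = (\<Prod>e\<leftarrow>es. [:- e, 1:])"
  shows "\<exists>B P. similar_mat_wit A B P P\<^sup>T \<and> diagonal_mat B \<and> diag_mat B = es"
  using assms
proof (induction es arbitrary: n A)
  case Nil
  with degree_monic_char_poly[of A n] have "n = 0" by simp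
  with Nil(1) have "similar_mat_wit A A (1\<^sub>m 0) (1\<^sub>m 0)\<^sup>T \<and> diagonal_mat A \<and> diag_mat A = []"
    by (auto simp: diag_mat_def diagonal_mat_def intro: similar_mat_wit_refl)
  then show ?case by blast
next
  case (Cons e es n A)
  note A = Cons.prems(1) and sym = Cons.prems(2)
  let ?cp = "char_poly A"
  have cp: "?cp = [: -e, 1 :] * (\<Prod>e \<leftarrow> es. [:- e, 1:])"
    using Cons.prems(3) by simp
  have mon: "monic (\<Prod>e\<leftarrow>es. [:- e, 1:])" by (rule monic_prod_list) auto
  have "degree ?cp = Suc (degree (\<Prod>e\<leftarrow>es. [:- e, 1:]))" unfolding cp
    using mon by (subst degree_mult_eq) auto
  with degree_monic_char_poly[OF A] have n: "n \<noteq> 0" by auto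
  define m where "m = n - 1"
  have n_m: "n = Suc m" using n by (simp add: m_def)
  have "eigenvalue A e"
    unfolding eigenvalue_root_char_poly[OF A] cp by simp
  then obtain u where u: "u \<in> carrier_vec n" "u \<noteq> 0\<^sub>v n" "A *\<^sub>v u = e \<cdot>\<^sub>v u"
    using A unfolding eigenvalue_def eigenvector_def by auto
  have upos: "u \<bullet> u > 0"
    using u(1,2) conjugate_square_greater_0_vec[of u n] by (simp add: conjugate_vec_def)
  define v where "v = (1 / sqrt (u \<bullet> u)) \<cdot>\<^sub>v u"
  have v: "v \<in> carrier_vec n" "v \<bullet> v = 1"
    using u(1) upos by (auto simp: v_def)
  have Av: "A *\<^sub>v v = e \<cdot>\<^sub>v v"
    using u A by (simp add: v_def mult_mat_vec smult_smult_assoc mult.commute)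
  obtain W where W: "W \<in> carrier_mat n n" "W\<^sup>T * W = 1\<^sub>m n" "W * W\<^sup>T = 1\<^sub>m n" "col W 0 = v"
    using orthonormal_basis_extension[OF v] by blast
  have WT: "W\<^sup>T \<in> carrier_mat n n" using W(1) by simp
  define A' where "A' = W\<^sup>T * A * W"
  have A': "A' \<in> carrier_mat n n"
    using A W(1) WT by (simp add: A'_def)
  have symA': "A'\<^sup>T = A'"
    using A W(1) WT by (simp add: A'_def transpose_mult[of _ n n _ n] sym assoc_mult_mat[of _ n n _ n _ n])
  have AA': "similar_mat_wit A A' W W\<^sup>T"
  proof (rule similar_mat_witI[of _ _ n])
    have "W * A' * W\<^sup>T = (W * W\<^sup>T) * A * (W * W\<^sup>T)"
      unfolding A'_def using A W(1) WT by (simp add: assoc_mult_mat[of _ n n _ n _ n])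
    then show "A = W * A' * W\<^sup>T"
      using A by (simp add: W(3))
  qed (use A A' W WT in auto)
  have col0: "A' $$ (i, 0) = (if i = 0 then e else 0)" if "i < n" for i
  proof -
    have "A' = W\<^sup>T * (A * W)"
      unfolding A'_def using A W(1) WT by (simp add: assoc_mult_mat[of _ n n _ n _ n])
    then have "A' $$ (i, 0) = col W i \<bullet> (A *\<^sub>v col W 0)"
      using that n A W(1) by (simp add: col_mult2[of A n n W n] mult_mat_vec_def)
    also have "\<dots> = e * ((W\<^sup>T * W) $$ (i, 0))"
      using that n W(1) v Av by (simp add: W(4))
    finally show ?thesis
      using that n by (simp add: W(2))
  qed
  \<comment> \<open>Symmetry clears the first row along with the first column, so the outcome is
    diagonal and not merely triangular.\<close>
  have row0: "A' $$ (0, j) = (if j = 0 then e else 0)" if "j < n" for j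
    using col0[OF that] arg_cong[OF symA', of "\<lambda>M. M $$ (j, 0)"] A' that n by simp
  define A1 where "A1 = mat 1 1 (\<lambda>_. e)"
  define A3 where "A3 = mat m m (\<lambda>(i, j). A' $$ (Suc i, Suc j))"
  have A1: "A1 \<in> carrier_mat 1 1" and A3: "A3 \<in> carrier_mat m m"
    by (simp_all add: A1_def A3_def)
  have block: "A' = four_block_mat A1 (0\<^sub>m 1 m) (0\<^sub>m m 1) A3"
    using A' by (intro eq_matI) (auto simp: A1_def A3_def n_m col0 row0)
  have symA3: "A3\<^sup>T = A3"
  proof (rule eq_matI)
    fix i j assume "i < dim_row A3" "j < dim_col A3"
    then show "A3\<^sup>T $$ (i, j) = A3 $$ (i, j)"
      using arg_cong[OF symA', of "\<lambda>M. M $$ (Suc i, Suc j)"] A' by (simp add: A3_def n_m)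
  qed (simp_all add: A3_def)
  have "char_poly A = char_poly A'"
    using AA' char_poly_similar unfolding similar_mat_def by blast
  also have "\<dots> = char_poly A1 * char_poly A3"
    unfolding block by (rule char_poly_four_block_zeros_col[OF A1 _ A3]) simp
  also have "char_poly A1 = [: -e,1 :]"
    by (simp add: A1_def char_poly_defs det_def sign_def)
  finally have "char_poly A3 = (\<Prod>e \<leftarrow> es. [:- e, 1:])"
    using cp by (metis mult_cancel_left pCons_eq_0_iff zero_neq_one)
  from Cons.IH[OF A3 symA3 this] obtain B P where
    BP: "similar_mat_wit A3 B P P\<^sup>T" "diagonal_mat B" "diag_mat B = es"
    by blast
  from similar_mat_witD2[OF A3 BP(1)]
  have B: "B \<in> carrier_mat m m" and P: "P \<in> carrier_mat m m"
    by auto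
  define C where "C = four_block_mat A1 (0\<^sub>m 1 m) (0\<^sub>m m 1) B"
  define R where "R = four_block_mat (1\<^sub>m 1) (0\<^sub>m 1 m) (0\<^sub>m m 1) P"
  have R: "R \<in> carrier_mat n n"
    unfolding R_def n_m using P by (intro carrier_matI) auto
  have RT: "R\<^sup>T = four_block_mat (1\<^sub>m 1) (0\<^sub>m 1 m) (0\<^sub>m m 1) P\<^sup>T"
    unfolding R_def using P by (subst transpose_four_block_mat[of _ 1 1 _ m _ m]) auto
  have "similar_mat_wit A' C R R\<^sup>T"
    unfolding block C_def RT unfolding R_def
    by (rule similar_mat_wit_four_block[OF similar_mat_wit_refl[OF A1] BP(1)]) (use A1 A3 P in auto)
  then have "similar_mat_wit A C (W * R) (R\<^sup>T * W\<^sup>T)"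
    by (rule similar_mat_wit_trans[OF AA'])
  then have "similar_mat_wit A C (W * R) (W * R)\<^sup>T"
    using W(1) R by (simp add: transpose_mult[of W n n R n])
  moreover have "diagonal_mat C"
    using BP(2) B unfolding diagonal_mat_def C_def A1_def by auto
  moreover have "diag_mat C = e # es"
    using diag_four_block_mat[OF A1 B] BP(3) by (simp add: C_def A1_def diag_mat_def)
  ultimately show ?case by blast
qed

lemma proots_prod_list_linear:
  "proots (\<Prod>e\<leftarrow>es. [:- e, 1:]) = mset (es :: 'a :: idom list)"
proof (induction es)
  case (Cons e es)
  have "(\<Prod>e\<leftarrow>es. [:- e, 1:]) \<noteq> 0"
    by (auto simp: prod_list_zero_iff)
  with Cons show ?case
    by (simp add: proots_mult del: mult_pCons_left)
qed simp

text \<open>Completeness of the basis is encoded as Parseval's identity, the form in which vectors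
  are expanded later; \<open>spectrum\<close> ties the \<open>d k\<close> to the roots with
  multiplicity.\<close>

locale orthonormal_eigenbasis =
  fixes A :: "real mat" and n :: nat and p :: "nat \<Rightarrow> real vec" and d :: "nat \<Rightarrow> real"
  assumes A: "A \<in> carrier_mat n n" and sym: "A\<^sup>T = A"
    and basis_carrier: "k < n \<Longrightarrow> p k \<in> carrier_vec n"
    and orthonormal: "k < n \<Longrightarrow> l < n \<Longrightarrow> p k \<bullet> p l = (if k = l then 1 else 0)"
    and parseval: "x \<in> carrier_vec n \<Longrightarrow> y \<in> carrier_vec n \<Longrightarrow>
      x \<bullet> y = (\<Sum>k<n. (p k \<bullet> x) * (p k \<bullet> y))"
    and eigen: "k < n \<Longrightarrow> A *\<^sub>v p k = d k \<cdot>\<^sub>v p k"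
    and spectrum: "proots (char_poly A) = image_mset d (mset_set {..<n})"

theorem spectral_theorem_symmetric:
  fixes A :: "real mat"
  assumes A: "A \<in> carrier_mat n n" and sym: "A\<^sup>T = A"
  obtains p d where "orthonormal_eigenbasis A n p d"
proof -
  obtain es where es: "char_poly A = (\<Prod>e\<leftarrow>es. [:- e, 1:])"
    using symmetric_char_poly_splits[OF A sym] by blast
  obtain B P where BP: "similar_mat_wit A B P P\<^sup>T" "diagonal_mat B" "diag_mat B = es"
    using orthogonal_diagonalization[OF A sym es] by blast
  note w = similar_mat_witD2[OF A BP(1)]
  have P: "P \<in> carrier_mat n n" and B: "B \<in> carrier_mat n n"
    using w by auto
  have PT: "P\<^sup>T \<in> carrier_mat n n"
    using P by simp
  have "A * P = P * B * (P\<^sup>T * P)"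
    using w(3) P B PT by (simp add: assoc_mult_mat[of _ n n _ n _ n])
  then have AP: "A * P = P * B"
    using w(2) P B by simp
  have "orthonormal_eigenbasis A n (col P) (\<lambda>k. B $$ (k, k))"
  proof
    show "col P k \<bullet> col P l = (if k = l then 1 else 0)" if "k < n" "l < n" for k l
      using arg_cong[OF w(2), of "\<lambda>M. M $$ (k, l)"] that P by simp
  next
    fix x y :: "real vec" assume xy: "x \<in> carrier_vec n" "y \<in> carrier_vec n"
    have c: "P\<^sup>T *\<^sub>v y \<in> carrier_vec n"
      using xy(2) PT by simp
    have "x \<bullet> y = x \<bullet> (P *\<^sub>v (P\<^sup>T *\<^sub>v y))"
      using xy P PT w(1) by (simp flip: assoc_mult_mat_vec[of P n n "P\<^sup>T" n y])
    also have "\<dots> = (P\<^sup>T *\<^sub>v x) \<bullet> (P\<^sup>T *\<^sub>v y)"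
      using transpose_vec_mult_scalar[OF P c xy(1)] by simp
    also have "\<dots> = (\<Sum>k<n. (col P k \<bullet> x) * (col P k \<bullet> y))"
      using P by (simp add: scalar_prod_def[of "P\<^sup>T *\<^sub>v x"] atLeast0LessThan)
    finally show "x \<bullet> y = \<dots>" .
  next
    fix k assume k: "k < n"
    have Bk: "col B k = B $$ (k, k) \<cdot>\<^sub>v unit_vec n k"
      using BP(2) B k by (intro eq_vecI) (auto simp: diagonal_mat_def)
    have "A *\<^sub>v col P k = P *\<^sub>v col B k"
      using arg_cong[OF AP, of "\<lambda>M. col M k"] A P B k
      by (simp add: col_mult2[of _ n n _ n] mult_mat_vec_def)
    then show "A *\<^sub>v col P k = B $$ (k, k) \<cdot>\<^sub>v col P k"
      using P k by (intro eq_vecI) (simp_all add: Bk mult_mat_vec[of P n n])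
  next
    have "mset es = image_mset (\<lambda>k. B $$ (k, k)) (mset_set {..<n})"
      unfolding BP(3)[symmetric] diag_mat_def using B
      by (simp add: mset_map atLeast0LessThan flip: mset_set_upto_eq_mset_upto)
    then show "proots (char_poly A) = image_mset (\<lambda>k. B $$ (k, k)) (mset_set {..<n})"
      by (simp add: es proots_prod_list_linear)
  qed (use A sym P in auto)
  then show thesis by (rule that)
qed

context orthonormal_eigenbasis
begin

lemma basis_scalar_mult:
  assumes "k < n" "x \<in> carrier_vec n"
  shows "p k \<bullet> (A *\<^sub>v x) = d k * (p k \<bullet> x)"
  using transpose_vec_mult_scalar[OF A assms(2) basis_carrier[OF assms(1)]] assms basis_carrier A
  by (simp add: sym eigen)

lemma coordinate_eq_0:
  assumes "x \<in> carrier_vec n" "A *\<^sub>v x = c \<cdot>\<^sub>v x" "k < n" "d k \<noteq> c"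
  shows "p k \<bullet> x = 0"
  using basis_scalar_mult[of k x] assms basis_carrier by simp

lemma eq_0_if_coordinates_0:
  assumes x: "x \<in> carrier_vec n" and 0: "\<And>k. k < n \<Longrightarrow> p k \<bullet> x = 0"
  shows "x = 0\<^sub>v n"
proof -
  have "x \<bullet> x = 0"
    using parseval[OF x x] 0 by simp
  then show ?thesis
    using x conjugate_square_eq_0_vec[of x n] by (simp add: conjugate_vec_def)
qed

text \<open>Converse of \<open>coordinate_eq_0\<close>: together they say that the eigenspace for
  \<open>c\<close> is spanned by the \<open>p k\<close> with \<open>d k = c\<close>.\<close>

lemma eigenvector_if_coordinates_0:
  assumes x: "x \<in> carrier_vec n" and 0: "\<And>k. k < n \<Longrightarrow> d k \<noteq> c \<Longrightarrow> p k \<bullet> x = 0"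
  shows "A *\<^sub>v x = c \<cdot>\<^sub>v x"
proof -
  have Ax: "A *\<^sub>v x \<in> carrier_vec n"
    using A x by simp
  have "A *\<^sub>v x - c \<cdot>\<^sub>v x = 0\<^sub>v n"
  proof (rule eq_0_if_coordinates_0)
    fix k assume k: "k < n"
    have "p k \<bullet> (A *\<^sub>v x - c \<cdot>\<^sub>v x) = (d k - c) * (p k \<bullet> x)"
      using x Ax basis_carrier[OF k] k
      by (simp add: scalar_prod_minus_distrib[of _ n] basis_scalar_mult algebra_simps)
    then show "p k \<bullet> (A *\<^sub>v x - c \<cdot>\<^sub>v x) = 0"
      using 0[OF k] by auto
  qed (use x Ax in auto)
  show ?thesis
  proof (rule eq_vecI)
    fix i assume "i < dim_vec (c \<cdot>\<^sub>v x)"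
    then show "(A *\<^sub>v x) $ i = (c \<cdot>\<^sub>v x) $ i"
      using arg_cong[OF \<open>A *\<^sub>v x - c \<cdot>\<^sub>v x = 0\<^sub>v n\<close>, of "\<lambda>v. v $ i"] x Ax A by simp
  qed (use x A in auto)
qed

lemma count_spectrum: "count (proots (char_poly A)) c = card {k. k < n \<and> d k = c}"
  unfolding spectrum
  by (auto simp: count_image_mset' intro!: arg_cong[of _ _ card])

lemma card_spectrum: "size (proots (char_poly A)) = n"
  by (simp add: spectrum)

end

section \<open>Comparison of multiplicities for two symmetric matrices\<close>

text \<open>The squares \<open>(p i \<bullet> q j)\<^sup>2\<close> form a doubly stochastic matrix; both multiplicities are
  compared with the sum of its entries over the indices of the two eigenspaces.\<close>
lemma
  assumes "orthonormal_eigenbasis A n p d" "orthonormal_eigenbasis B n q e"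
    and sub: "\<And>x. x \<in> carrier_vec n \<Longrightarrow> B *\<^sub>v x = b \<cdot>\<^sub>v x \<Longrightarrow> A *\<^sub>v x = a \<cdot>\<^sub>v x"
  shows multiplicity_mono: "count (proots (char_poly B)) b \<le> count (proots (char_poly A)) a"
    and multiplicity_strict_mono: "\<And>x. x \<in> carrier_vec n \<Longrightarrow> A *\<^sub>v x = a \<cdot>\<^sub>v x \<Longrightarrow> B *\<^sub>v x \<noteq> b \<cdot>\<^sub>v x \<Longrightarrow>
      count (proots (char_poly B)) b < count (proots (char_poly A)) a"
proof -
  interpret A: orthonormal_eigenbasis A n p d by fact
  interpret B: orthonormal_eigenbasis B n q e by fact
  define I where "I = {i. i < n \<and> d i = a}"
  define J where "J = {j. j < n \<and> e j = b}"
  have fin: "finite I" "finite J"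
    by (simp_all add: I_def J_def)
  have sq: "(q j \<bullet> p i)\<^sup>2 = (p i \<bullet> q j)\<^sup>2" if "i < n" "j < n" for i j
    using that comm_scalar_prod[of "q j" n "p i"] A.basis_carrier B.basis_carrier by simp
  have J: "(\<Sum>i\<in>I. (p i \<bullet> q j)\<^sup>2) = 1" if "j \<in> J" for j
  proof -
    have j: "j < n" "q j \<in> carrier_vec n" "e j = b"
      using that B.basis_carrier by (auto simp: J_def)
    have "A *\<^sub>v q j = a \<cdot>\<^sub>v q j"
      using sub[OF j(2)] B.eigen[OF j(1)] j(3) by simp
    then have 0: "p i \<bullet> q j = 0" if "i < n" "i \<notin> I" for i
      using A.coordinate_eq_0[OF j(2)] that by (auto simp: I_def)
    have "1 = (\<Sum>i<n. (p i \<bullet> q j)\<^sup>2)"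
      using A.parseval[OF j(2) j(2)] B.orthonormal[of j j] j by (simp add: power2_eq_square)
    also have "\<dots> = (\<Sum>i\<in>I. (p i \<bullet> q j)\<^sup>2)"
      using 0 by (intro sum.mono_neutral_right) (auto simp: I_def)
    finally show ?thesis by simp
  qed
  have total: "(\<Sum>j<n. (p i \<bullet> q j)\<^sup>2) = 1" if "i < n" for i
    using B.parseval[of "p i" "p i"] A.basis_carrier[OF that] A.orthonormal[of i i] that
    by (simp add: power2_eq_square[symmetric] sq)
  have I: "(\<Sum>j\<in>J. (p i \<bullet> q j)\<^sup>2) \<le> 1" if "i \<in> I" for i
  proof -
    have "(\<Sum>j\<in>J. (p i \<bullet> q j)\<^sup>2) \<le> (\<Sum>j<n. (p i \<bullet> q j)\<^sup>2)"
      by (rule sum_mono2) (auto simp: J_def)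
    then show ?thesis
      using total that by (simp add: I_def)
  qed
  \<comment> \<open>Double counting: a column in \<open>J\<close> sums to exactly 1 over
    \<open>I\<close>, because \<open>q j\<close> lies in the eigenspace of \<open>A\<close>, while a
    row sums to at most 1 over \<open>J\<close>.\<close>
  have cJ: "real (card J) = (\<Sum>i\<in>I. \<Sum>j\<in>J. (p i \<bullet> q j)\<^sup>2)"
    using J by (subst sum.swap) simp
  also have "\<dots> \<le> (\<Sum>i\<in>I. 1)"
    by (rule sum_mono) (rule I)
  finally show "count (proots (char_poly B)) b \<le> count (proots (char_poly A)) a"
    unfolding A.count_spectrum B.count_spectrum by (simp add: I_def J_def)
  fix x assume x: "x \<in> carrier_vec n" "A *\<^sub>v x = a \<cdot>\<^sub>v x" "B *\<^sub>v x \<noteq> b \<cdot>\<^sub>v x"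
  \<comment> \<open>\<open>x\<close> is spanned by the \<open>p i\<close> with \<open>i\<close> in
    \<open>I\<close>, yet has a component along some \<open>q j\<close> with \<open>j\<close>
    outside \<open>J\<close>. Hence some row in \<open>I\<close> has a nonzero entry outside
    \<open>J\<close> and sums to less than 1 over \<open>J\<close>.\<close>
  obtain j where j: "j < n" "e j \<noteq> b" "q j \<bullet> x \<noteq> 0"
    using B.eigenvector_if_coordinates_0[OF x(1)] x(3) by blast
  have "q j \<bullet> x = (\<Sum>i<n. (p i \<bullet> q j) * (p i \<bullet> x))"
    using A.parseval[of "q j" x] B.basis_carrier[OF j(1)] x(1) by simp
  then obtain i where i: "i < n" "p i \<bullet> q j \<noteq> 0" "p i \<bullet> x \<noteq> 0"
    using j(3) by (auto elim: sum.not_neutral_contains_not_neutral)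
  then have iI: "i \<in> I"
    using A.coordinate_eq_0[OF x(1,2)] by (auto simp: I_def)
  have "(\<Sum>j\<in>J. (p i \<bullet> q j)\<^sup>2) < (\<Sum>j<n. (p i \<bullet> q j)\<^sup>2)"
    by (rule sum_strict_mono2[of _ _ j]) (use i j in \<open>auto simp: J_def\<close>)
  then have "(\<Sum>i\<in>I. \<Sum>j\<in>J. (p i \<bullet> q j)\<^sup>2) < (\<Sum>i\<in>I. 1)"
    using total[OF i(1)] I iI by (intro sum_strict_mono_ex1 fin) auto
  with cJ show "count (proots (char_poly B)) b < count (proots (char_poly A)) a"
    unfolding A.count_spectrum B.count_spectrum by (simp add: I_def J_def)
qed

section \<open>Main eigenvalues and the largest eigenvalue\<close>

lemma mult_mat_vec_index_sum:
  assumes "A \<in> carrier_mat m n" "x \<in> carrier_vec n" "i < m"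
  shows "(A *\<^sub>v x) $ i = (\<Sum>j<n. A $$ (i, j) * x $ j)"
  using assms by (simp add: scalar_prod_def atLeast0LessThan)

abbreviation ones :: "nat \<Rightarrow> real vec" where
  "ones n \<equiv> vec n (\<lambda>_. 1)"

lemma scalar_prod_ones:
  fixes x :: "real vec"
  assumes "x \<in> carrier_vec n"
  shows "x \<bullet> ones n = (\<Sum>i<n. x $ i)"
  using assms by (simp add: scalar_prod_def atLeast0LessThan)

text \<open>On vectors orthogonal to \<^term>\<open>ones n\<close> the eigenspaces of \<open>A\<close> for \<open>a\<close> and of \<open>B\<close> for
  \<open>- 1 - a\<close> agree. If one eigenvector for \<open>a\<close> is not orthogonal to it, then all eigenvectors of \<open>B\<close>
  for \<open>- 1 - a\<close> are, so that eigenspace is strictly smaller.\<close>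
lemma main_iff_multiplicity_less:
  assumes "orthonormal_eigenbasis A n p d" "orthonormal_eigenbasis B n q e"
    and AB: "\<And>i j. i < n \<Longrightarrow> j < n \<Longrightarrow> A $$ (i, j) + B $$ (i, j) = (if i = j then 0 else 1)"
  shows "(\<exists>v. eigenvector A v a \<and> v \<bullet> ones n \<noteq> 0) \<longleftrightarrow>
    count (proots (char_poly B)) (- 1 - a) < count (proots (char_poly A)) a"
proof -
  interpret A: orthonormal_eigenbasis A n p d by fact
  interpret B: orthonormal_eigenbasis B n q e by fact
  have sum: "(A *\<^sub>v x) $ i + (B *\<^sub>v x) $ i = x \<bullet> ones n - x $ i"
    if x: "x \<in> carrier_vec n" and i: "i < n" for x i
  proof -
    have "(A *\<^sub>v x) $ i + (B *\<^sub>v x) $ i = (\<Sum>j<n. (A $$ (i, j) + B $$ (i, j)) * x $ j)"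
      using x i mult_mat_vec_index_sum[OF A.A x] mult_mat_vec_index_sum[OF B.A x]
      by (simp add: sum.distrib algebra_simps)
    also have "\<dots> = (\<Sum>j<n. x $ j - (if j = i then x $ j else 0))"
      using i by (intro sum.cong) (auto simp: AB)
    also have "\<dots> = x \<bullet> ones n - x $ i"
      using x i by (simp add: sum_subtractf scalar_prod_ones)
    finally show ?thesis .
  qed
  have agree: "A *\<^sub>v x = a \<cdot>\<^sub>v x \<longleftrightarrow> B *\<^sub>v x = (- 1 - a) \<cdot>\<^sub>v x"
    if x: "x \<in> carrier_vec n" "x \<bullet> ones n = 0" for x
  proof -
    have "(A *\<^sub>v x) $ i = a * x $ i \<longleftrightarrow> (B *\<^sub>v x) $ i = (- 1 - a) * x $ i" if "i < n" for i
      using sum[OF x(1) that] x(2) by (auto simp: algebra_simps)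
    then show ?thesis
      using x A.A B.A by (auto simp: vec_eq_iff)
  qed
  show ?thesis
  proof
    assume "\<exists>v. eigenvector A v a \<and> v \<bullet> ones n \<noteq> 0"
    then obtain v where v: "v \<in> carrier_vec n" "A *\<^sub>v v = a \<cdot>\<^sub>v v" "v \<bullet> ones n \<noteq> 0"
      using A.A by (auto simp: eigenvector_def)
    show "count (proots (char_poly B)) (- 1 - a) < count (proots (char_poly A)) a"
    proof (rule multiplicity_strict_mono[OF assms(1,2) _ v(1,2)])
      fix x assume x: "x \<in> carrier_vec n" "B *\<^sub>v x = (- 1 - a) \<cdot>\<^sub>v x"
      \<comment> \<open>On \<open>x\<close> the matrix \<open>A\<close> acts as \<open>a\<close>
        plus the coordinate sum of \<open>x\<close> times the all-one vector. Pairing with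
        \<open>v\<close> and using symmetry leaves
        \<open>(x \<bullet> ones n) * (v \<bullet> ones n) = 0\<close>.\<close>
      have "(A *\<^sub>v x) $ i = a * x $ i + x \<bullet> ones n" if "i < n" for i
        using sum[OF x(1) that] x that by (simp add: algebra_simps)
      then have "v \<bullet> (A *\<^sub>v x) = (\<Sum>i<n. v $ i * (a * x $ i + x \<bullet> ones n))"
        using A.A by (simp add: scalar_prod_def[of v] atLeast0LessThan)
      also have "\<dots> = a * (v \<bullet> x) + (x \<bullet> ones n) * (v \<bullet> ones n)"
        using v(1) x(1) unfolding scalar_prod_ones[OF v(1)] scalar_prod_def[of v x]
        by (simp add: algebra_simps sum.distrib sum_distrib_left sum_distrib_right
          atLeast0LessThan)
      finally have "v \<bullet> (A *\<^sub>v x) = a * (v \<bullet> x) + (x \<bullet> ones n) * (v \<bullet> ones n)" .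
      moreover have "v \<bullet> (A *\<^sub>v x) = a * (v \<bullet> x)"
        using transpose_vec_mult_scalar[OF A.A x(1) v(1)] v x(1) by (simp add: A.sym)
      ultimately have "x \<bullet> ones n = 0"
        using v(3) by simp
      then show "A *\<^sub>v x = a \<cdot>\<^sub>v x"
        using agree[OF x(1)] x(2) by blast
    next
      \<comment> \<open>Any coordinate will do: if \<open>v\<close> were an eigenvector of
        \<open>B\<close> as well, the identity \<open>sum\<close> at \<open>i\<close> would force
        \<open>v \<bullet> ones n = 0\<close>.\<close>
      obtain i where i: "i < n"
        using v(3) scalar_prod_ones[OF v(1)] by (metis lessThan_iff sum.neutral)
      show "B *\<^sub>v v \<noteq> (- 1 - a) \<cdot>\<^sub>v v"
      proof
        assume "B *\<^sub>v v = (- 1 - a) \<cdot>\<^sub>v v"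
        then show False
          using sum[OF v(1) i] v i by (simp add: algebra_simps)
      qed
    qed
  next
    assume less: "count (proots (char_poly B)) (- 1 - a) < count (proots (char_poly A)) a"
    show "\<exists>v. eigenvector A v a \<and> v \<bullet> ones n \<noteq> 0"
    proof (rule ccontr)
      assume contr: "\<not> ?thesis"
      have "count (proots (char_poly A)) a \<le> count (proots (char_poly B)) (- 1 - a)"
      proof (rule multiplicity_mono[OF assms(2,1)])
        fix x assume x: "x \<in> carrier_vec n" "A *\<^sub>v x = a \<cdot>\<^sub>v x"
        have "x \<bullet> ones n = 0"
        proof (cases "x = 0\<^sub>v n")
          case False
          with x have "eigenvector A x a"
            using A.A by (simp add: eigenvector_def)
          with contr show ?thesis by blast
        qed simp
        then show "B *\<^sub>v x = (- 1 - a) \<cdot>\<^sub>v x"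
          using agree[OF x(1)] x(2) by blast
      qed
      with less show False by simp
    qed
  qed
qed

text \<open>Both sides are the trace of \<open>A * A\<close>. Parseval is applied to the rows, whose
  coordinates are \<open>d k * p k $ i\<close>.\<close>

lemma (in orthonormal_eigenbasis) sum_squares_entries:
  "(\<Sum>i<n. \<Sum>j<n. (A $$ (i, j))\<^sup>2) = (\<Sum>a\<in>#proots (char_poly A). a\<^sup>2)"
proof -
  have "(\<Sum>i<n. \<Sum>j<n. (A $$ (i, j))\<^sup>2) = (\<Sum>i<n. row A i \<bullet> row A i)"
    using A by (intro sum.cong) (auto simp: scalar_prod_def atLeast0LessThan power2_eq_square)
  also have "\<dots> = (\<Sum>i<n. \<Sum>k<n. (d k)\<^sup>2 * (p k $ i)\<^sup>2)"
  proof (intro sum.cong refl)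
    fix i assume "i \<in> {..<n}"
    then have i: "i < n" and r: "row A i \<in> carrier_vec n"
      using A by auto
    have pr: "p k \<bullet> row A i = d k * p k $ i" if "k < n" for k
    proof -
      have "p k \<bullet> row A i = (A *\<^sub>v p k) $ i"
        using i A r basis_carrier[OF that] comm_scalar_prod[of "p k" n "row A i"] by simp
      then show ?thesis
        using i basis_carrier[OF that] by (simp add: eigen[OF that])
    qed
    show "row A i \<bullet> row A i = (\<Sum>k<n. (d k)\<^sup>2 * (p k $ i)\<^sup>2)"
      unfolding parseval[OF r r] by (intro sum.cong) (auto simp: pr power2_eq_square)
  qed
  also have "\<dots> = (\<Sum>k<n. (d k)\<^sup>2 * (p k \<bullet> p k))"
    using basis_carrier
    by (subst sum.swap)
      (auto simp: scalar_prod_def atLeast0LessThan power2_eq_square sum_distrib_left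
        dest!: carrier_vecD intro!: sum.cong)
  also have "\<dots> = (\<Sum>k<n. (d k)\<^sup>2)"
    by (simp add: orthonormal)
  also have "\<dots> = (\<Sum>a\<in>#proots (char_poly A). a\<^sup>2)"
    by (simp add: spectrum image_mset.compositionality o_def sum_unfold_sum_mset)
  finally show ?thesis .
qed

section \<open>Perron's argument for symmetric nonnegative matrices\<close>

text \<open>Irreducibility in the sense of Perron and Frobenius.\<close>
definition support_connected :: "nat \<Rightarrow> real mat \<Rightarrow> bool" where
  "support_connected n A \<longleftrightarrow>
     (\<forall>S \<subseteq> {..<n}. S \<noteq> {} \<longrightarrow> (\<forall>i\<in>S. \<forall>j<n. A $$ (i, j) \<noteq> 0 \<longrightarrow> j \<in> S) \<longrightarrow> S = {..<n})"

locale perron = orthonormal_eigenbasis +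
  assumes n_pos: "n > 0" and nonneg: "i < n \<Longrightarrow> j < n \<Longrightarrow> A $$ (i, j) \<ge> 0"
    and connected: "support_connected n A"
begin

definition top_eigenvalue :: real where
  "top_eigenvalue = Max (d ` {..<n})"

lemma top_eigenvalue_ge: "k < n \<Longrightarrow> d k \<le> top_eigenvalue"
  by (simp add: top_eigenvalue_def)

lemma top_eigenvalue_attained: "\<exists>k<n. d k = top_eigenvalue"
  using Max_in[of "d ` {..<n}"] n_pos unfolding top_eigenvalue_def by (fastforce simp: lessThan_empty_iff)

lemma quadratic_form_eq:
  assumes "x \<in> carrier_vec n"
  shows "x \<bullet> (A *\<^sub>v x) = (\<Sum>k<n. d k * (p k \<bullet> x)\<^sup>2)"
  using parseval[of x "A *\<^sub>v x"] A assms
  by (simp add: basis_scalar_mult power2_eq_square mult_ac)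

text \<open>Taking absolute values keeps the norm and cannot lower the quadratic form of a
  nonnegative matrix. As \<open>x\<close> already attains the maximum for its norm, so does its
  absolute value, which forces the coordinates at smaller eigenvalues to vanish.\<close>

lemma abs_top_eigenvector:
  assumes x: "x \<in> carrier_vec n" "A *\<^sub>v x = top_eigenvalue \<cdot>\<^sub>v x"
  shows "A *\<^sub>v map_vec abs x = top_eigenvalue \<cdot>\<^sub>v map_vec abs x"
proof (rule eigenvector_if_coordinates_0)
  let ?y = "map_vec abs x"
  show y: "?y \<in> carrier_vec n"
    using x by simp
  have quad: "z \<bullet> (A *\<^sub>v z) = (\<Sum>i<n. \<Sum>j<n. A $$ (i, j) * (z $ i * z $ j))" if "z \<in> carrier_vec n" for z
  proof -
    have "z \<bullet> (A *\<^sub>v z) = (\<Sum>i<n. z $ i * (A *\<^sub>v z) $ i)"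
      using A by (simp add: scalar_prod_def[of z] atLeast0LessThan)
    then show ?thesis
      using mult_mat_vec_index_sum[OF A that] by (simp add: sum_distrib_left mult_ac)
  qed
  have "top_eigenvalue * (\<Sum>k<n. (p k \<bullet> ?y)\<^sup>2) = top_eigenvalue * (?y \<bullet> ?y)"
    by (simp add: parseval[OF y y] power2_eq_square)
  also have "\<dots> = top_eigenvalue * (x \<bullet> x)"
    using x(1) by (simp add: scalar_prod_def)
  also have "\<dots> = x \<bullet> (A *\<^sub>v x)"
    using x by simp
  also have "\<dots> \<le> ?y \<bullet> (A *\<^sub>v ?y)"
    unfolding quad[OF x(1)] quad[OF y] using x(1) nonneg
    by (intro sum_mono) (auto simp flip: abs_mult intro!: mult_left_mono)
  also have "\<dots> = (\<Sum>k<n. d k * (p k \<bullet> ?y)\<^sup>2)"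
    by (rule quadratic_form_eq[OF y])
  finally have "(\<Sum>k<n. (top_eigenvalue - d k) * (p k \<bullet> ?y)\<^sup>2) \<le> 0"
    by (simp add: left_diff_distrib sum_subtractf sum_distrib_left)
  moreover have *: "(top_eigenvalue - d k) * (p k \<bullet> ?y)\<^sup>2 \<ge> 0" if "k < n" for k
    using top_eigenvalue_ge[OF that] by simp
  ultimately have sum0: "(\<Sum>k<n. (top_eigenvalue - d k) * (p k \<bullet> ?y)\<^sup>2) = 0"
    by (intro antisym sum_nonneg) auto
  fix k assume k: "k < n" "d k \<noteq> top_eigenvalue"
  have "(top_eigenvalue - d k) * (p k \<bullet> ?y)\<^sup>2 = 0"
    using sum_nonneg_0[OF _ _ sum0, of k] * k(1) by auto
  with k(2) show "p k \<bullet> ?y = 0"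
    by simp
qed

text \<open>Where \<open>x\<close> vanishes, the eigenvalue equation for its absolute value is a
  zero sum of nonnegative terms, so \<open>x\<close> vanishes at all neighbours too. Connectedness
  spreads the zero everywhere.\<close>

lemma top_eigenvector_nonzero:
  assumes x: "x \<in> carrier_vec n" "A *\<^sub>v x = top_eigenvalue \<cdot>\<^sub>v x" and x0: "x \<noteq> 0\<^sub>v n"
    and i: "i < n"
  shows "x $ i \<noteq> 0"
proof
  assume xi: "x $ i = 0"
  define S where "S = {i. i < n \<and> x $ i = 0}"
  let ?y = "map_vec abs x"
  have "j \<in> S" if k: "k \<in> S" and j: "j < n" "A $$ (k, j) \<noteq> 0" for k j
  proof -
    have kn: "k < n" "x $ k = 0"
      using k by (auto simp: S_def)
    have "(\<Sum>j<n. A $$ (k, j) * \<bar>x $ j\<bar>) = (A *\<^sub>v ?y) $ k"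
      using x(1) kn by (simp add: mult_mat_vec_index_sum[OF A])
    also have "\<dots> = 0"
      unfolding abs_top_eigenvector[OF x] using x(1) kn by simp
    finally have "A $$ (k, j) * \<bar>x $ j\<bar> = 0"
      using sum_nonneg_eq_0_iff[of "{..<n}" "\<lambda>j. A $$ (k, j) * \<bar>x $ j\<bar>"] nonneg kn(1) j(1)
      by auto
    with j show ?thesis
      by (simp add: S_def)
  qed
  moreover have "S \<subseteq> {..<n}" "S \<noteq> {}"
    using i xi by (auto simp: S_def)
  ultimately have "S = {..<n}"
    using connected unfolding support_connected_def by blast
  then have "x $ j = 0" if "j < n" for j
    using that by (auto simp: S_def)
  then have "x = 0\<^sub>v n"
    using x(1) by (intro eq_vecI) auto
  with x0 show False ..
qed

lemma basis_neq_0: "k < n \<Longrightarrow> p k \<noteq> 0\<^sub>v n"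
  using orthonormal[of k k] by auto

text \<open>From two basis vectors for this eigenvalue one could combine an eigenvector that
  vanishes at coordinate 0 but is itself nonzero.\<close>

lemma top_eigenvalue_simple: "count (proots (char_poly A)) top_eigenvalue = 1"
proof -
  obtain k where k: "k < n" "d k = top_eigenvalue"
    using top_eigenvalue_attained by blast
  have "l = k" if l: "l < n" "d l = top_eigenvalue" for l
  proof (rule ccontr)
    assume lk: "l \<noteq> k"
    define z where "z = p l $ 0 \<cdot>\<^sub>v p k - p k $ 0 \<cdot>\<^sub>v p l"
    have c: "p k \<in> carrier_vec n" "p l \<in> carrier_vec n"
      using k l basis_carrier by auto
    have z: "z \<in> carrier_vec n"
      using c by (simp add: z_def)
    have "A *\<^sub>v z = top_eigenvalue \<cdot>\<^sub>v z"
    proof (rule eigenvector_if_coordinates_0[OF z])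
      fix j assume j: "j < n" "d j \<noteq> top_eigenvalue"
      then have "j \<noteq> k" "j \<noteq> l"
        using k l by auto
      then show "p j \<bullet> z = 0"
        using j k l c basis_carrier[OF j(1)]
        by (simp add: z_def scalar_prod_minus_distrib[of _ n] orthonormal)
    qed
    moreover have "z $ 0 = 0"
      using c n_pos by (simp add: z_def)
    ultimately have "z = 0\<^sub>v n"
      using top_eigenvector_nonzero[OF z] n_pos by blast
    then have "p k \<bullet> z = 0"
      using c by simp
    moreover have "p k \<bullet> z = p l $ 0"
      using k l c lk by (simp add: z_def scalar_prod_minus_distrib[of _ n] orthonormal)
    ultimately show False
      using top_eigenvector_nonzero[OF c(2) _ basis_neq_0[OF l(1)] n_pos] eigen[OF l(1)] l by simp
  qed
  with k have "{k. k < n \<and> d k = top_eigenvalue} = {k}"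
    by blast
  then show ?thesis
    by (simp add: count_spectrum)
qed

text \<open>The absolute value of a top eigenvector is again one, and all its entries are
  positive.\<close>

lemma top_eigenvalue_main: "\<exists>v. eigenvector A v top_eigenvalue \<and> v \<bullet> ones n \<noteq> 0"
proof -
  obtain k where k: "k < n" "d k = top_eigenvalue"
    using top_eigenvalue_attained by blast
  have c: "p k \<in> carrier_vec n" "A *\<^sub>v p k = top_eigenvalue \<cdot>\<^sub>v p k"
    using k basis_carrier eigen by auto
  let ?y = "map_vec abs (p k)"
  have "?y \<bullet> ones n = (\<Sum>i<n. \<bar>p k $ i\<bar>)"
    using c(1) by (simp add: scalar_prod_ones[of _ n])
  also have "\<dots> > 0"
    using top_eigenvector_nonzero[OF c basis_neq_0[OF k(1)]] n_pos by (intro sum_pos) auto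
  finally have pos: "?y \<bullet> ones n > 0" .
  moreover have "?y \<noteq> 0\<^sub>v n"
    using pos by auto
  ultimately show ?thesis
    using abs_top_eigenvector[OF c] c(1) A by (auto simp: eigenvector_def intro!: exI[of _ ?y])
qed

end

section \<open>Irreducibility over the rationals\<close>

text \<open>If \<open>q\<close> did not divide \<open>f\<close>, the two would be coprime, and a
  Bezout identity evaluated at the common root \<open>z\<close> would read 0 = 1.\<close>

lemma root_if_common_root_irreducible:
  fixes q f :: "rat poly" and z c :: real
  assumes irr: "irreducible q"
    and "poly (map_poly of_rat q) z = 0" "poly (map_poly of_rat f) z = 0"
    and c: "poly (map_poly of_rat q) c = 0"
  shows "poly (map_poly of_rat f) c = 0"
proof -
  interpret P: map_poly_inj_comm_ring_hom "of_rat :: rat \<Rightarrow> real" ..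
  have "q dvd f"
  proof (rule ccontr)
    assume "\<not> q dvd f"
    have "coprime q f"
    proof (rule coprimeI)
      fix r assume r: "r dvd q" "r dvd f"
      then have "q dvd r \<or> is_unit r"
        using irreducibleD'[OF irr] by blast
      then show "is_unit r"
        using r(2) \<open>\<not> q dvd f\<close> dvd_trans by blast
    qed
    then obtain u v where "u * q + v * f = 1"
      using bezout_coefficients_fst_snd[of q f] by (metis coprime_imp_gcd_eq_1)
    then have "map_poly of_rat u * map_poly of_rat q + map_poly of_rat v * map_poly of_rat f = (1 :: real poly)"
      by (metis P.hom_add P.hom_mult P.hom_one)
    then have "poly (map_poly of_rat u * map_poly of_rat q + map_poly of_rat v * map_poly of_rat f) z = 1"
      by simp
    then show False
      using assms(2,3) by simp
  qed
  then show ?thesis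
    using c by (auto simp: P.hom_mult elim!: dvdE)
qed

text \<open>The restriction of \<open>A\<close> to the block \<open>S\<close>, padded with zeros, has a rational characteristic
  polynomial and some main eigenvalue, which is also main for \<open>A\<close> and hence a root of \<open>q\<close>. By
  irreducibility the characteristic polynomial then has all roots of \<open>q\<close>. Padding only adds
  the eigenvalue 0, which is why \<open>c\<close> must be nonzero.\<close>
lemma (in orthonormal_eigenbasis) eigenvector_supported_on_block:
  assumes rat: "\<forall>i<n. \<forall>j<n. A $$ (i, j) \<in> \<rat>"
    and S: "S \<subseteq> {..<n}" "S \<noteq> {}"
    and block: "\<forall>i<n. \<forall>j<n. A $$ (i, j) \<noteq> 0 \<longrightarrow> (i \<in> S \<longleftrightarrow> j \<in> S)"
    and irr: "irreducible (q :: rat poly)"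
    and main: "\<forall>a. (\<exists>v. eigenvector A v a \<and> v \<bullet> ones n \<noteq> 0) \<longrightarrow> poly (map_poly of_rat q) a = 0"
    and c: "poly (map_poly of_rat q) c = 0" "c \<noteq> 0"
  obtains x where "eigenvector A x c" "\<And>i. i < n \<Longrightarrow> i \<notin> S \<Longrightarrow> x $ i = 0"
proof -
  define B where "B = mat n n (\<lambda>(i, j). if i \<in> S \<and> j \<in> S then A $$ (i, j) else 0)"
  have B: "B \<in> carrier_mat n n"
    by (simp add: B_def)
  have symA: "A $$ (i, j) = A $$ (j, i)" if "i < n" "j < n" for i j
    using arg_cong[OF sym, of "\<lambda>M. M $$ (j, i)"] A that by simp
  have "B\<^sup>T = B"
    by (intro eq_matI) (auto simp: B_def symA)
  then obtain r e where "orthonormal_eigenbasis B n r e"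
    using spectral_theorem_symmetric[OF B] by blast
  then interpret B: orthonormal_eigenbasis B n r e .
  \<comment> \<open>The all-one vector of the block. It is nonzero, so some eigenvector
    \<open>r k\<close> of \<open>B\<close> is not orthogonal to it.\<close>
  define s where "s = vec n (\<lambda>i. if i \<in> S then 1 else 0 :: real)"
  have s: "s \<in> carrier_vec n" "s \<noteq> 0\<^sub>v n"
    using S by (auto simp: s_def vec_eq_iff)
  then obtain k where k: "k < n" "r k \<bullet> s \<noteq> 0"
    using B.eq_0_if_coordinates_0 by blast
  have rk: "r k \<in> carrier_vec n" "B *\<^sub>v r k = e k \<cdot>\<^sub>v r k"
    using k B.basis_carrier B.eigen by auto
  \<comment> \<open>If \<open>e k = 0\<close>, then \<open>r k\<close> may have entries outside
    \<open>S\<close>. Cutting them off keeps the product with \<open>s\<close>.\<close>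
  define u where "u = vec n (\<lambda>i. if i \<in> S then r k $ i else 0)"
  have u: "u \<in> carrier_vec n"
    by (simp add: u_def)
  have us: "u \<bullet> ones n = r k \<bullet> s"
    unfolding u_def s_def by (auto simp: scalar_prod_def intro!: sum.cong)
  have "A *\<^sub>v u = e k \<cdot>\<^sub>v u"
  proof (rule eq_vecI)
    fix i assume "i < dim_vec (e k \<cdot>\<^sub>v u)"
    then have i: "i < n" using u by simp
    show "(A *\<^sub>v u) $ i = (e k \<cdot>\<^sub>v u) $ i"
    proof (cases "i \<in> S")
      case True
      then have "(A *\<^sub>v u) $ i = (B *\<^sub>v r k) $ i"
        unfolding mult_mat_vec_index_sum[OF A u i] mult_mat_vec_index_sum[OF B rk(1) i]
        using i by (intro sum.cong) (auto simp: B_def u_def)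
      with True show ?thesis
        using i rk u by (simp add: u_def)
    next
      case False
      then have "(A *\<^sub>v u) $ i = 0"
        unfolding mult_mat_vec_index_sum[OF A u i]
        using i block by (intro sum.neutral) (auto simp: u_def)
      with False show ?thesis
        using i u by (simp add: u_def)
    qed
  qed (use A u in auto)
  moreover have "u \<noteq> 0\<^sub>v n"
    using k(2) us by auto
  ultimately have "eigenvector A u (e k)"
    using A u by (simp add: eigenvector_def)
  then have qk: "poly (map_poly of_rat q) (e k) = 0"
    using main k(2) us by metis
  \<comment> \<open>Rational preimages of the entries, so that the characteristic polynomial of
    \<open>B\<close> comes from one over the rationals.\<close>
  define BQ where "BQ = mat n n (\<lambda>ij. SOME t :: rat. of_rat t = B $$ ij)"
  have BQ: "BQ \<in> carrier_mat n n"
    by (simp add: BQ_def)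
  have "\<exists>t :: rat. of_rat t = B $$ (i, j)" if "i < n" "j < n" for i j
  proof -
    have "B $$ (i, j) \<in> \<rat>"
      using rat that by (simp add: B_def)
    then show ?thesis
      by (auto elim: Rats_cases)
  qed
  then have "map_mat of_rat BQ = B"
    using B by (intro eq_matI) (auto simp: BQ_def intro: someI_ex)
  then have cp: "map_poly of_rat (char_poly BQ) = char_poly B"
    using of_rat_hom.char_poly_hom[OF BQ, where ?'a = real] by simp
  have "eigenvalue B (e k)"
    using rk k B.orthonormal[of k k] B unfolding eigenvalue_def eigenvector_def by force
  then have "poly (map_poly of_rat (char_poly BQ)) (e k) = 0"
    by (simp add: cp eigenvalue_root_char_poly[OF B])
  then have "poly (char_poly B) c = 0"
    using root_if_common_root_irreducible[OF irr qk _ c(1)] cp by metis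
  then obtain x where x: "x \<in> carrier_vec n" "x \<noteq> 0\<^sub>v n" "B *\<^sub>v x = c \<cdot>\<^sub>v x"
    using B unfolding eigenvalue_root_char_poly[OF B, symmetric] eigenvalue_def eigenvector_def by auto
  have supp: "x $ i = 0" if i: "i < n" "i \<notin> S" for i
  proof -
    have "(B *\<^sub>v x) $ i = 0"
      unfolding mult_mat_vec_index_sum[OF B x(1) i(1)]
      using i by (intro sum.neutral) (auto simp: B_def)
    then show ?thesis
      using i x c(2) by simp
  qed
  have "A *\<^sub>v x = B *\<^sub>v x"
  proof (rule eq_vecI)
    fix i assume "i < dim_vec (B *\<^sub>v x)"
    then have i: "i < n" using B by simp
    show "(A *\<^sub>v x) $ i = (B *\<^sub>v x) $ i"
      unfolding mult_mat_vec_index_sum[OF A x(1) i] mult_mat_vec_index_sum[OF B x(1) i]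
      using i supp block by (intro sum.cong) (auto simp: B_def)
  qed (use A B in auto)
  then have "eigenvector A x c"
    using x A by (simp add: eigenvector_def)
  then show thesis
    using supp by (rule that)
qed

text \<open>Eigenvectors for \<open>c\<close> supported on complementary blocks are orthogonal,
  so a simple eigenvalue cannot occur on both.\<close>
lemma (in orthonormal_eigenbasis) support_connected_if_simple_root:
  assumes rat: "\<forall>i<n. \<forall>j<n. A $$ (i, j) \<in> \<rat>"
    and irr: "irreducible (q :: rat poly)"
    and main: "\<forall>a. (\<exists>v. eigenvector A v a \<and> v \<bullet> ones n \<noteq> 0) \<longrightarrow> poly (map_poly of_rat q) a = 0"
    and c: "poly (map_poly of_rat q) c = 0" "c \<noteq> 0"
    and simple: "count (proots (char_poly A)) c = 1"
  shows "support_connected n A"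
  unfolding support_connected_def
proof (intro allI impI)
  fix S assume S: "S \<subseteq> {..<n}" "S \<noteq> {}" "\<forall>i\<in>S. \<forall>j<n. A $$ (i, j) \<noteq> 0 \<longrightarrow> j \<in> S"
  have symA: "A $$ (i, j) = A $$ (j, i)" if "i < n" "j < n" for i j
    using arg_cong[OF sym, of "\<lambda>M. M $$ (j, i)"] A that by simp
  have block: "\<forall>i<n. \<forall>j<n. A $$ (i, j) \<noteq> 0 \<longrightarrow> (i \<in> S \<longleftrightarrow> j \<in> S)"
    using S(3) symA by metis
  show "S = {..<n}"
  proof (rule ccontr)
    assume "S \<noteq> {..<n}"
    then have ne: "{..<n} - S \<noteq> {}"
      using S(1) by blast
    have block': "\<forall>i<n. \<forall>j<n. A $$ (i, j) \<noteq> 0 \<longrightarrow> (i \<in> {..<n} - S \<longleftrightarrow> j \<in> {..<n} - S)"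
      using block by simp
    obtain y where y: "eigenvector A y c" "\<And>i. i < n \<Longrightarrow> i \<notin> {..<n} - S \<Longrightarrow> y $ i = 0"
      using eigenvector_supported_on_block[OF rat Diff_subset ne block' irr main c] by blast
    obtain x where x: "eigenvector A x c" "\<And>i. i < n \<Longrightarrow> i \<notin> S \<Longrightarrow> x $ i = 0"
      using eigenvector_supported_on_block[OF rat S(1,2) block irr main c] by blast
    have xy: "x \<in> carrier_vec n" "y \<in> carrier_vec n" "x \<noteq> 0\<^sub>v n" "y \<noteq> 0\<^sub>v n"
      "A *\<^sub>v x = c \<cdot>\<^sub>v x" "A *\<^sub>v y = c \<cdot>\<^sub>v y"
      using x(1) y(1) A by (auto simp: eigenvector_def)
    \<comment> \<open>Both \<open>x\<close> and \<open>y\<close> have their only nonzero coordinate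
      at \<open>k\<close>, so their product is nonzero, against their disjoint supports.\<close>
    obtain k where k: "{k. k < n \<and> d k = c} = {k}"
      using simple unfolding count_spectrum by (rule card_1_singletonE)
    then have other: "d j \<noteq> c" if "j < n" "j \<noteq> k" for j
      using that by auto
    have px: "p j \<bullet> x = 0" "p j \<bullet> y = 0" if "j < n" "j \<noteq> k" for j
      using coordinate_eq_0[OF xy(1,5)] coordinate_eq_0[OF xy(2,6)] other that by auto
    have "p k \<bullet> x \<noteq> 0" "p k \<bullet> y \<noteq> 0"
      using eq_0_if_coordinates_0[OF xy(1)] eq_0_if_coordinates_0[OF xy(2)] xy(3,4) px by metis+
    moreover have "x \<bullet> y = (p k \<bullet> x) * (p k \<bullet> y)"
    proof -
      have "k < n" using k by auto
      then show ?thesis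
        unfolding parseval[OF xy(1,2)] using px
        by (subst sum.remove[of _ k]) (auto intro!: sum.neutral)
    qed
    moreover have "x \<bullet> y = 0"
      using xy(1,2) x(2) y(2) unfolding scalar_prod_def
      by (intro sum.neutral) (metis atLeastLessThan_iff carrier_vecD mult_zero_left mult_zero_right DiffD2)
    ultimately show False
      by simp
  qed
qed

text \<open>Supplies the nonzero \<open>c\<close> of the block argument. For \<open>n > 1\<close>
  connectedness gives row 0 a nonzero entry, so the product of that row with a positive top
  eigenvector is not 0.\<close>

lemma (in perron) top_eigenvalue_neq_0_or_n_eq_1: "top_eigenvalue \<noteq> 0 \<or> n = 1"
proof (rule disjCI)
  assume "\<not> n = 1"
  then have n: "n > 1" using n_pos by simp
  obtain k where k: "k < n" "d k = top_eigenvalue"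
    using top_eigenvalue_attained by blast
  have c: "p k \<in> carrier_vec n" "A *\<^sub>v p k = top_eigenvalue \<cdot>\<^sub>v p k"
    using k basis_carrier eigen by auto
  have "{0} \<noteq> {..<n}"
    using n by (metis lessThan_iff singletonD zero_neq_one)
  then obtain j where j: "j < n" "A $$ (0, j) \<noteq> 0"
    using connected n_pos unfolding support_connected_def
    by (smt (verit) insert_not_empty lessThan_iff singletonD subset_eq)
  show "top_eigenvalue \<noteq> 0"
  proof
    assume 0: "top_eigenvalue = 0"
    have "(\<Sum>j<n. A $$ (0, j) * \<bar>p k $ j\<bar>) = (A *\<^sub>v map_vec abs (p k)) $ 0"
      using c(1) n_pos by (simp add: mult_mat_vec_index_sum[OF A])
    also have "\<dots> = 0"
      using c(1) n_pos by (simp add: abs_top_eigenvector[OF c] 0)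
    finally have sum0: "(\<Sum>j<n. A $$ (0, j) * \<bar>p k $ j\<bar>) = 0" .
    have "A $$ (0, j) * \<bar>p k $ j\<bar> = 0"
      using sum_nonneg_0[OF _ _ sum0, of j] nonneg n_pos j(1) by auto
    then show False
      using top_eigenvector_nonzero[OF c basis_neq_0[OF k(1)] j(1)] j(2) by simp
  qed
qed

section \<open>Counting the arcs of a tree\<close>

text \<open>Connectedness is strong connectedness of the symmetric closure, and a symmetric graph is
  its own closure.\<close>

lemma (in pair_graph) connected_iff_reachable:
  "Digraph_Component.connected (with_proj G) \<longleftrightarrow>
     pverts G \<noteq> {} \<and> (\<forall>u\<in>pverts G. \<forall>v\<in>pverts G. u \<rightarrow>\<^sup>*\<^bsub>with_proj G\<^esub> v)"
proof -
  have "mk_symmetric (with_proj G) = G"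
    by (intro pair_pre_digraph.equality) (auto simp: mk_symmetric_def arcs_symmetric)
  then show ?thesis
    by (simp add: connected_def strongly_connected_def)
qed

text \<open>A rooted spanning tree given by parent pointers; the strict decrease of
  \<open>dist\<close> makes every chain of parents end at \<open>r\<close>.\<close>

locale bfs_tree = pair_graph +
  fixes r :: 'a and par :: "'a \<Rightarrow> 'a" and dist :: "'a \<Rightarrow> nat"
  assumes root: "r \<in> pverts G"
    and par: "v \<in> pverts G \<Longrightarrow> v \<noteq> r \<Longrightarrow> (par v, v) \<in> parcs G \<and> dist (par v) < dist v"
begin

definition tree_arcs :: "('a \<times> 'a) set" where
  "tree_arcs = (\<lambda>v. (v, par v)) ` (pverts G - {r}) \<union> (\<lambda>v. (par v, v)) ` (pverts G - {r})"

lemma tree_arcs_subset: "tree_arcs \<subseteq> parcs G"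
  using par by (auto simp: tree_arcs_def dest: arcs_symmetric)

text \<open>Upward and downward arcs are distinct, since two vertices cannot be parents of each
  other: \<open>dist\<close> would decrease both ways.\<close>

lemma card_tree_arcs: "card tree_arcs = 2 * (card (pverts G) - 1)"
proof -
  have "(\<lambda>v. (v, par v)) ` (pverts G - {r}) \<inter> (\<lambda>v. (par v, v)) ` (pverts G - {r}) = {}"
  proof (rule equals0I)
    fix a assume "a \<in> (\<lambda>v. (v, par v)) ` (pverts G - {r}) \<inter> (\<lambda>v. (par v, v)) ` (pverts G - {r})"
    then obtain v w where "v \<in> pverts G - {r}" "w \<in> pverts G - {r}" "v = par w" "par v = w"
      by auto
    then show False
      using par[of v] par[of w] by auto
  qed
  then have "card tree_arcs = card (pverts G - {r}) + card (pverts G - {r})"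
    unfolding tree_arcs_def using pair_finite_verts
    by (subst card_Un_disjoint) (auto simp: card_image inj_on_def)
  then show ?thesis
    using root pair_finite_verts by simp
qed

lemma dist_le_imp_parent:
  assumes "(u, v) \<in> tree_arcs" "dist v \<le> dist u"
  shows "v = par u"
  using assms par unfolding tree_arcs_def by fastforce

lemma root_reachable:
  assumes "v \<in> pverts G"
  shows "(v, r) \<in> tree_arcs\<^sup>*"
  using assms
proof (induction "dist v" arbitrary: v rule: less_induct)
  case less
  show ?case
  proof (cases "v = r")
    case False
    with less.prems have "(par v, r) \<in> tree_arcs\<^sup>*"
      using par[of v] by (intro less.hyps) (auto dest: in_arcsD1)
    moreover have "(v, par v) \<in> tree_arcs"
      using less.prems False by (auto simp: tree_arcs_def)
    ultimately show ?thesis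
      by (rule converse_rtrancl_into_rtrancl[rotated])
  qed simp
qed

lemma sym_tree_arcs: "sym tree_arcs"
  by (auto simp: sym_def tree_arcs_def)

lemma tree_arcs_connected:
  assumes "u \<in> pverts G" "v \<in> pverts G"
  shows "(u, v) \<in> tree_arcs\<^sup>*"
  using root_reachable[OF assms(1)] root_reachable[OF assms(2)] sym_rtrancl[OF sym_tree_arcs]
  by (meson rtrancl_trans symD)

text \<open>The arc is closed up by the tree path from \<open>v\<close> back to \<open>u\<close>.
  That path has at least two arcs, because \<open>u\<close> and \<open>v\<close> differ and are not
  adjacent in the tree.\<close>

lemma cycle_if_non_tree_arc:
  assumes uv: "(u, v) \<in> parcs G" "(u, v) \<notin> tree_arcs"
  shows "\<exists>p. cycle p \<and> length p \<ge> 3"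
proof -
  define H where "H = \<lparr> pverts = pverts G, parcs = tree_arcs \<rparr>"
  interpret H: pair_wf_digraph H
    using tree_arcs_subset in_arcsD1 in_arcsD2 by unfold_locales (force simp: H_def)+
  have V: "u \<in> pverts G" "v \<in> pverts G"
    using uv(1) by (auto dest: in_arcsD1 in_arcsD2)
  have "v \<rightarrow>\<^sup>*\<^bsub>with_proj H\<^esub> u"
    using tree_arcs_connected[OF V(2,1)] V H.reachable_conv' by (simp add: H_def)
  then obtain p where p: "H.apath v p u"
    using H.reachable_apath by blast
  have aw: "awalk v p u" and dist: "distinct (pawalk_verts v p)" and sub: "set p \<subseteq> tree_arcs"
    using p tree_arcs_subset V unfolding H.apath_def H.awalk_def awalk_def by (auto simp: H_def)
  have "(v, u) \<notin> tree_arcs"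
    using uv(2) sym_tree_arcs by (auto simp: sym_def)
  have "u \<noteq> v"
    using uv(1) no_loops' by blast
  have len: "length p \<ge> 2"
  proof (rule ccontr)
    assume "\<not> ?thesis"
    then consider "p = []" | a where "p = [a]"
      by (cases p rule: list.exhaust; cases "tl p") auto
    then show False
    proof cases
      case 1
      then show ?thesis using aw \<open>u \<noteq> v\<close> by (simp add: awalk_Nil_iff)
    next
      case 2
      then show ?thesis using aw sub \<open>(v, u) \<notin> tree_arcs\<close> by (cases a) (auto simp: awalk_simps)
    qed
  qed
  have "cycle ((u, v) # p)"
    unfolding cycle_def using aw dist uv(1) by (intro exI[of _ u]) (auto simp: awalk_Cons_iff)
  with len show ?thesis
    by (intro exI[of _ "(u, v) # p"]) simp
qed

text \<open>In a cycle of tree arcs, a vertex with maximal \<open>dist\<close> would have its parent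
  as both neighbours, but on a cycle of length at least 3 these are distinct.\<close>

lemma non_tree_arc_if_cycle:
  assumes "cycle p" "length p \<ge> 3"
  shows "\<exists>a\<in>parcs G. a \<notin> tree_arcs"
proof (rule ccontr)
  assume contr: "\<not> ?thesis"
  obtain u where u: "awalk u p u" "distinct (tl (pawalk_verts u p))" "p \<noteq> []"
    using assms(1) unfolding cycle_def by auto
  have pc: "pcas u p u" "set p \<subseteq> parcs G"
    using u(1) by (auto simp: awalk_def)
  have "pawalk_verts u p = (if p = [] then [u] else fst (hd p) # map snd p)"
    using awalk_verts_conv'[OF pc(1)] .
  then have dist: "distinct (map snd p)"
    using u(2,3) by simp
  have next_arc: "snd (es ! i) = fst (es ! Suc i)" if "pcas x es y" "Suc i < length es" for x y es i
    using that
  proof (induction es arbitrary: x i)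
    case (Cons e es)
    then show ?case
      by (cases i; cases es) auto
  qed simp
  have "snd (last p) = fst (hd p)"
    using pc(1) u(3) awlast_if_cas[OF pc(1)] awhd_if_cas[OF pc(1)] awalk_verts_conv[of u p]
    by (cases p) auto
  then have wrap: "snd (p ! (length p - 1)) = fst (p ! 0)"
    using u(3) by (simp add: last_conv_nth hd_conv_nth)
  define m where "m = length p"
  define s where "s i = Suc i mod m" for i
  have m: "m \<ge> 3" using assms(2) by (simp add: m_def)
  have succ: "snd (p ! i) = fst (p ! s i)" "s i < m" if "i < m" for i
  proof -
    show "snd (p ! i) = fst (p ! s i)"
    proof (cases "Suc i = m")
      case True
      then have "i = length p - 1" by (simp add: m_def)
      then show ?thesis using wrap True by (simp add: s_def)
    next
      case False
      then show ?thesis using that next_arc[OF pc(1), of i] by (simp add: s_def m_def)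
    qed
    show "s i < m" using m by (simp add: s_def)
  qed
  have tree: "p ! i \<in> tree_arcs" if "i < m" for i
    using nth_mem[of i p] that pc(2) contr unfolding m_def by blast
  obtain i where i: "i < m" and max: "\<And>j. j < m \<Longrightarrow> dist (snd (p ! j)) \<le> dist (snd (p ! i))"
  proof -
    have "finite {..<m}" "{..<m} \<noteq> {}" using m by (simp_all add: lessThan_empty_iff)
    then have "Max ((\<lambda>j. dist (snd (p ! j))) ` {..<m}) \<in> (\<lambda>j. dist (snd (p ! j))) ` {..<m}"
      by (intro Max_in) simp_all
    then obtain i where "i < m" "Max ((\<lambda>j. dist (snd (p ! j))) ` {..<m}) = dist (snd (p ! i))"
      by (elim imageE) simp
    moreover have "dist (snd (p ! j)) \<le> Max ((\<lambda>j. dist (snd (p ! j))) ` {..<m})" if "j < m" for j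
      using that by (intro Max_ge) auto
    ultimately show thesis using that by metis
  qed
  define w where "w = snd (p ! i)"
  obtain h where h: "h < m" "s h = i"
  proof (cases i)
    case 0
    show thesis by (rule that[of "m - 1"]) (use m 0 in \<open>auto simp: s_def\<close>)
  next
    case (Suc h)
    show thesis by (rule that[of h]) (use i Suc in \<open>auto simp: s_def\<close>)
  qed
  have "p ! i = (snd (p ! h), w)"
    using succ(1)[OF h(1)] h(2) by (simp add: w_def prod_eq_iff)
  then have "(w, snd (p ! h)) \<in> tree_arcs"
    using tree[OF i] sym_tree_arcs by (metis symD)
  then have 1: "snd (p ! h) = par w"
    using max[OF h(1)] by (intro dist_le_imp_parent) (auto simp: w_def)
  have "p ! s i = (w, snd (p ! s i))"
    using succ(1)[OF i] by (simp add: w_def prod_eq_iff)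
  then have "(w, snd (p ! s i)) \<in> tree_arcs"
    using tree[OF succ(2)[OF i]] by metis
  then have 2: "snd (p ! s i) = par w"
    using max[OF succ(2)[OF i]] by (intro dist_le_imp_parent) (auto simp: w_def)
  \<comment> \<open>The arcs before and after \<open>p ! i\<close> have the same head, so their
    indices agree; but they differ by 2 modulo \<open>m\<close>, and \<open>m\<close> is at least
    3.\<close>
  have "h = s i"
    using nth_eq_iff_index_eq[OF dist, of h "s i"] 1 2 h(1) succ(2)[OF i] by (simp add: m_def)
  then have "Suc (Suc h mod m) mod m = h"
    using h(2) by (simp add: s_def)
  then have "(h + 2) mod m = h"
    by (simp add: mod_Suc_eq)
  then show False
    using h(1) m by (cases "h + 2 < m") (auto simp: mod_if split: if_splits)
qed

theorem acyclic_iff_card_arcs: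
  "(\<nexists>p. cycle p \<and> length p \<ge> 3) \<longleftrightarrow> card (parcs G) = 2 * (card (pverts G) - 1)"
proof -
  have "(\<nexists>p. cycle p \<and> length p \<ge> 3) \<longleftrightarrow> parcs G \<subseteq> tree_arcs"
    using cycle_if_non_tree_arc non_tree_arc_if_cycle by fast
  also have "\<dots> \<longleftrightarrow> card (parcs G) = card tree_arcs"
    using tree_arcs_subset pair_finite_arcs by (metis card_subset_eq subset_antisym order_refl)
  finally show ?thesis
    by (simp add: card_tree_arcs)
qed

end

text \<open>The parent of \<open>v\<close> is the last vertex before \<open>v\<close> on a shortest
  walk from the root.\<close>

lemma (in pair_graph) bfs_tree_exists:
  assumes "Digraph_Component.connected (with_proj G)"
  obtains r par dist where "bfs_tree G r par dist"
proof -
  obtain r where r: "r \<in> pverts G"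
    and reach: "\<And>v. v \<in> pverts G \<Longrightarrow> (r, v) \<in> (parcs G)\<^sup>*"
    using assms unfolding connected_iff_reachable
    by (metis ex_in_conv reachable_rtranclI with_proj_simps(3))
  define dist where "dist v = (LEAST k. (r, v) \<in> parcs G ^^ k)" for v
  have "\<exists>u. (u, v) \<in> parcs G \<and> dist u < dist v" if v: "v \<in> pverts G" "v \<noteq> r" for v
  proof -
    have "(r, v) \<in> parcs G ^^ dist v"
      unfolding dist_def using rtrancl_imp_relpow[OF reach[OF v(1)]] by (rule LeastI_ex)
    moreover obtain k where k: "dist v = Suc k"
      using calculation v(2) by (cases "dist v") auto
    ultimately obtain u where u: "(r, u) \<in> parcs G ^^ k" "(u, v) \<in> parcs G"
      by auto
    then have "dist u \<le> k"
      unfolding dist_def by (intro Least_le)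
    with u k show ?thesis by auto
  qed
  then obtain par where "\<And>v. v \<in> pverts G \<Longrightarrow> v \<noteq> r \<Longrightarrow> (par v, v) \<in> parcs G \<and> dist (par v) < dist v"
    by metis
  then have "bfs_tree G r par dist"
    using r by unfold_locales auto
  then show thesis by (rule that)
qed

theorem (in pair_graph) undirected_tree_iff:
  "undirected_tree G \<longleftrightarrow> Digraph_Component.connected (with_proj G) \<and>
     card (parcs G) = 2 * (card (pverts G) - 1)"
  unfolding undirected_tree_def by (metis bfs_tree.acyclic_iff_card_arcs bfs_tree_exists)

section \<open>Spectra of graphs\<close>

context pair_graph
begin

abbreviation num_verts :: nat where "num_verts \<equiv> card (pverts G)"

lemma vert_list_bij: "bij_betw (\<lambda>i. vert_list G ! i) {..<num_verts} (pverts G)"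
  using bij_betw_nth[OF vert_list(1)[OF pair_finite_verts] refl refl] vert_list[OF pair_finite_verts]
  by (simp add: lessThan_def)

lemma vert_list_nth_in: "i < num_verts \<Longrightarrow> vert_list G ! i \<in> pverts G"
  using vert_list_bij by (auto dest: bij_betwE)

lemma vert_list_nth_eq_iff:
  "i < num_verts \<Longrightarrow> j < num_verts \<Longrightarrow> vert_list G ! i = vert_list G ! j \<longleftrightarrow> i = j"
  using vert_list[OF pair_finite_verts] by (simp add: nth_eq_iff_index_eq)

lemma vert_list_nth_obtain:
  assumes "v \<in> pverts G"
  obtains i where "i < num_verts" "vert_list G ! i = v"
  using assms vert_list_bij unfolding bij_betw_def by (metis imageE lessThan_iff)

lemma adjacency_matrix_carrier: "adjacency_matrix G \<in> carrier_mat num_verts num_verts"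
  by (simp add: adjacency_matrix_def)

lemma adjacency_matrix_index:
  "i < num_verts \<Longrightarrow> j < num_verts \<Longrightarrow>
     adjacency_matrix G $$ (i, j) = (if (vert_list G ! i, vert_list G ! j) \<in> parcs G then 1 else 0)"
  by (simp add: adjacency_matrix_def)

lemma adjacency_matrix_symmetric: "(adjacency_matrix G)\<^sup>T = adjacency_matrix G"
  by (intro eq_matI) (auto simp: adjacency_matrix_def dest: arcs_symmetric)

lemma adjacency_eigenbasis:
  obtains p d where "orthonormal_eigenbasis (adjacency_matrix G) num_verts p d"
  using spectral_theorem_symmetric[OF adjacency_matrix_carrier adjacency_matrix_symmetric] .

lemma size_adjacency_spectrum: "size (adjacency_spectrum G) = num_verts"
  using adjacency_eigenbasis orthonormal_eigenbasis.card_spectrum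
  unfolding adjacency_spectrum_def by metis

lemma card_parcs: "real (card (parcs G)) = (\<Sum>a\<in>#adjacency_spectrum G. a\<^sup>2)"
proof -
  let ?f = "\<lambda>u v. if (u, v) \<in> parcs G then 1 else 0 :: real"
  have "(\<Sum>a\<in>#adjacency_spectrum G. a\<^sup>2) =
      (\<Sum>i<num_verts. \<Sum>j<num_verts. (adjacency_matrix G $$ (i, j))\<^sup>2)"
    using adjacency_eigenbasis orthonormal_eigenbasis.sum_squares_entries
    unfolding adjacency_spectrum_def by metis
  also have "\<dots> = (\<Sum>i<num_verts. \<Sum>j<num_verts. ?f (vert_list G ! i) (vert_list G ! j))"
    by (intro sum.cong) (auto simp: adjacency_matrix_index)
  also have "\<dots> = (\<Sum>i<num_verts. \<Sum>v\<in>pverts G. ?f (vert_list G ! i) v)"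
    by (intro sum.cong refl sum.reindex_bij_betw[OF vert_list_bij])
  also have "\<dots> = (\<Sum>u\<in>pverts G. \<Sum>v\<in>pverts G. ?f u v)"
    by (rule sum.reindex_bij_betw[OF vert_list_bij])
  also have "\<dots> = (\<Sum>e\<in>pverts G \<times> pverts G. if e \<in> parcs G then 1 else 0)"
    by (simp add: sum.cartesian_product case_prod_unfold)
  also have "\<dots> = real (card ((pverts G \<times> pverts G) \<inter> parcs G))"
    using pair_finite_verts by (simp flip: sum.inter_restrict)
  also have "(pverts G \<times> pverts G) \<inter> parcs G = parcs G"
    by (auto dest: in_arcsD1 in_arcsD2)
  finally show ?thesis by simp
qed

lemma main_eigenvalue_iff:
  "main_eigenvalue G a \<longleftrightarrow>
     count (adjacency_spectrum (complement_graph G)) (- 1 - a) < count (adjacency_spectrum G) a"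
proof -
  interpret C: pair_graph "complement_graph G"
    by (rule pair_graph_complement_graph) (rule pair_graph)
  \<comment> \<open>The choice in \<open>vert_list\<close> depends only on the vertex set, so a
    graph and its complement are enumerated alike and their matrices can be added entrywise.\<close>
  have V: "pverts (complement_graph G) = pverts G"
    and L: "vert_list (complement_graph G) = vert_list G"
    and E: "\<And>u v. (u, v) \<in> parcs (complement_graph G) \<longleftrightarrow>
      u \<in> pverts G \<and> v \<in> pverts G \<and> u \<noteq> v \<and> (u, v) \<notin> parcs G"
    by (simp_all add: complement_graph_def vert_list_def)
  obtain p d where 1: "orthonormal_eigenbasis (adjacency_matrix G) num_verts p d"
    by (rule adjacency_eigenbasis)
  obtain q e where 2: "orthonormal_eigenbasis (adjacency_matrix (complement_graph G)) num_verts q e"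
    by (rule C.adjacency_eigenbasis[unfolded V])
  show ?thesis
    unfolding main_eigenvalue_def adjacency_spectrum_def
  proof (rule main_iff_multiplicity_less[OF 1 2])
    fix i j assume ij: "i < num_verts" "j < num_verts"
    then show "adjacency_matrix G $$ (i, j) + adjacency_matrix (complement_graph G) $$ (i, j) =
        (if i = j then 0 else 1)"
      using C.adjacency_matrix_index[of i j] vert_list_nth_in vert_list_nth_eq_iff[of i j] no_loops'
      by (auto simp: adjacency_matrix_index V L E)
  qed
qed

text \<open>Needed for \<open>main_poly\<close> to have the intended roots: a product over an
  infinite set is 1 by convention.\<close>

lemma finite_main_eigenvalues: "finite {a. main_eigenvalue G a}"
proof (rule finite_subset)
  show "{a. main_eigenvalue G a} \<subseteq> set_mset (adjacency_spectrum G)"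
    by (auto simp: main_eigenvalue_iff simp flip: count_greater_zero_iff)
qed simp

lemma poly_main_poly_eq_0_iff: "poly (main_poly G) a = 0 \<longleftrightarrow> main_eigenvalue G a"
  using finite_main_eigenvalues by (auto simp: main_poly_def poly_prod)

text \<open>A set of indices closed under the support is a union of components. The empty graph is
  excluded because it satisfies the matrix condition vacuously but does not count as
  connected.\<close>

lemma support_connected_adjacency_iff:
  assumes "pverts G \<noteq> {}"
  shows "support_connected num_verts (adjacency_matrix G) \<longleftrightarrow> Digraph_Component.connected (with_proj G)"
proof
  assume sc: "support_connected num_verts (adjacency_matrix G)"
  have "u \<rightarrow>\<^sup>*\<^bsub>with_proj G\<^esub> v" if u: "u \<in> pverts G" and v: "v \<in> pverts G" for u v
  proof -
    define S where "S = {i. i < num_verts \<and> u \<rightarrow>\<^sup>*\<^bsub>with_proj G\<^esub> vert_list G ! i}"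
    obtain i where i: "i < num_verts" "vert_list G ! i = u"
      using u by (rule vert_list_nth_obtain)
    have "S \<subseteq> {..<num_verts}" "i \<in> S"
      using i u by (auto simp: S_def)
    moreover have "\<forall>j\<in>S. \<forall>k<num_verts. adjacency_matrix G $$ (j, k) \<noteq> 0 \<longrightarrow> k \<in> S"
      by (auto simp: S_def adjacency_matrix_index split: if_splits intro: reachable_adj_trans)
    ultimately have "S = {..<num_verts}"
      using sc unfolding support_connected_def by blast
    then show ?thesis
      using v by (auto simp: S_def elim!: vert_list_nth_obtain)
  qed
  with assms show "Digraph_Component.connected (with_proj G)"
    by (simp add: connected_iff_reachable)
next
  assume conn: "Digraph_Component.connected (with_proj G)"
  show "support_connected num_verts (adjacency_matrix G)"
    unfolding support_connected_def
  proof (intro allI impI)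
    fix S assume S: "S \<subseteq> {..<num_verts}" "S \<noteq> {}"
      and closed: "\<forall>i\<in>S. \<forall>j<num_verts. adjacency_matrix G $$ (i, j) \<noteq> 0 \<longrightarrow> j \<in> S"
    obtain i where i: "i \<in> S" "i < num_verts"
      using S by blast
    have "\<exists>k\<in>S. vert_list G ! k = v" if "(vert_list G ! i, v) \<in> (parcs G)\<^sup>*" for v
      using that
    proof (induction rule: rtrancl_induct)
      case base
      show ?case using i by blast
    next
      case (step y z)
      then obtain k where k: "k \<in> S" "vert_list G ! k = y"
        by blast
      obtain l where l: "l < num_verts" "vert_list G ! l = z"
        using in_arcsD2[OF step.hyps(2)] by (rule vert_list_nth_obtain)
      have "k < num_verts"
        using k S by blast
      then have "adjacency_matrix G $$ (k, l) \<noteq> 0"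
        using step.hyps(2) k l by (simp add: adjacency_matrix_index)
      then show ?case
        using closed k(1) l by blast
    qed
    moreover have "(vert_list G ! i, vert_list G ! j) \<in> (parcs G)\<^sup>*" if "j < num_verts" for j
      using conn i that vert_list_nth_in reachable_rtranclI[of "with_proj G"]
      by (simp add: connected_iff_reachable)
    ultimately have "j \<in> S" if "j < num_verts" for j
      using that S vert_list_nth_eq_iff by (metis lessThan_iff subsetD)
    with S show "S = {..<num_verts}"
      by blast
  qed
qed

end

theorem corollary3p5:
  fixes T :: "'a pair_pre_digraph" and G :: "'b pair_pre_digraph"
  assumes "pair_graph T" and "undirected_tree T"
    and "irreducible_over_rat (main_poly T)"
    and "pair_graph G" and "generalized_cospectral G T"
  shows "undirected_tree G"
proof -
  interpret T: pair_graph T by fact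
  interpret G: pair_graph G by fact
  have spec: "adjacency_spectrum G = adjacency_spectrum T"
    "adjacency_spectrum (complement_graph G) = adjacency_spectrum (complement_graph T)"
    using assms(5) by (auto simp: generalized_cospectral_def)
  have num_verts: "G.num_verts = T.num_verts"
    using G.size_adjacency_spectrum T.size_adjacency_spectrum spec by simp
  have arcs: "card (parcs G) = card (parcs T)"
    using G.card_parcs T.card_parcs spec by simp
  have tree: "Digraph_Component.connected (with_proj T)" "card (parcs T) = 2 * (T.num_verts - 1)"
    using assms(2) by (simp_all add: T.undirected_tree_iff)
  then have neT: "pverts T \<noteq> {}"
    by (simp add: T.connected_iff_reachable)
  then have pos: "T.num_verts > 0"
    using T.pair_finite_verts by (simp add: card_gt_0_iff)
  then have neG: "pverts G \<noteq> {}"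
    using num_verts by auto
  obtain q :: "rat poly" where q: "map_poly of_rat q = main_poly T" "irreducible q"
    using assms(3) by (auto simp: irreducible_over_rat_def)
  obtain p d where "orthonormal_eigenbasis (adjacency_matrix T) T.num_verts p d"
    by (rule T.adjacency_eigenbasis)
  then interpret P: perron "adjacency_matrix T" T.num_verts p d
    using pos tree(1) neT
    by (intro perron.intro perron_axioms.intro)
      (auto simp: T.adjacency_matrix_index T.support_connected_adjacency_iff)
  obtain r e where "orthonormal_eigenbasis (adjacency_matrix G) G.num_verts r e"
    by (rule G.adjacency_eigenbasis)
  then interpret E: orthonormal_eigenbasis "adjacency_matrix G" G.num_verts r e .
  have "support_connected G.num_verts (adjacency_matrix G)"
    using P.top_eigenvalue_neq_0_or_n_eq_1
  proof
    assume c0: "P.top_eigenvalue \<noteq> 0"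
    show ?thesis
    \<comment> \<open>The number \<open>c\<close> is the top eigenvalue of \<open>T\<close>. For
      \<open>G\<close> it serves only as a simple eigenvalue that is a root of
      \<open>q\<close>.\<close>
    proof (rule E.support_connected_if_simple_root[OF _ q(2) _ _ c0])
      show "\<forall>i<G.num_verts. \<forall>j<G.num_verts. adjacency_matrix G $$ (i, j) \<in> \<rat>"
        by (simp add: G.adjacency_matrix_index)
      have "main_eigenvalue G a = main_eigenvalue T a" for a
        by (simp add: G.main_eigenvalue_iff T.main_eigenvalue_iff spec)
      then show "\<forall>a. (\<exists>v. eigenvector (adjacency_matrix G) v a \<and> v \<bullet> ones G.num_verts \<noteq> 0) \<longrightarrow>
          poly (map_poly of_rat q) a = 0"
        by (simp add: q(1) T.poly_main_poly_eq_0_iff flip: main_eigenvalue_def)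
      show "poly (map_poly of_rat q) P.top_eigenvalue = 0"
        using P.top_eigenvalue_main
        by (simp add: q(1) T.poly_main_poly_eq_0_iff main_eigenvalue_def)
      show "count (proots (char_poly (adjacency_matrix G))) P.top_eigenvalue = 1"
        using P.top_eigenvalue_simple spec(1) by (simp add: adjacency_spectrum_def)
    qed
  next
    \<comment> \<open>With a single index, the only nonempty set of indices is the whole
      set.\<close>
    assume "T.num_verts = 1"
    then show ?thesis
      by (auto simp: support_connected_def num_verts lessThan_Suc)
  qed
  then have "Digraph_Component.connected (with_proj G)"
    using G.support_connected_adjacency_iff[OF neG] by simp
  then show ?thesis
    by (simp add: G.undirected_tree_iff arcs tree(2) num_verts)
qed

end
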